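(* Let $\alpha\in\mathbb{R}\setminus\mathbb{Q}$, let $Tx=x+\alpha$ on $\mathbb{T}=\mathbb{R}/\mathbb{Z}$, and let $f:\mathbb{T}\to\mathbb{R}$ be a continuous positive function. If $\alpha$ is not a quadratic irrational, then $I_{top}(T^f)\subset\{1,-1\}$.
   Context: Topological special flow: $X^f$ is the quotient of $\mathbb{T}\times\mathbb{R}$ by the orbit relation of the homeomorphism $T_{-f}(x,r)=(Tx,r-f(x))$; the flow $\sigma_t(x,r)=(x,r+t)$ commutes with $T_{-f}$ and hence induces a continuous flow $T^f=(T^f_t)_{t\in\mathbb{R}}$ on the compact space $X^f$. For a continuous flow $\mathcal{T}=(T_t)_{t\in\mathbb{R}}$ on a compact metric space, $I_{top}(\mathcal{T})$ is the group of $s\in\mathbb{R}^*=\mathbb{R}\setminus\{0\}$ such that $\mathcal{T}$ and $\mathcal{T}\circ s=(T_{st})_{t\in\mathbb{R}}$ are topologically conjugate. *)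

theory Defs
  imports "HOL-Analysis.Analysis"
begin

text \<open>
  The points of the quotient of \<^term>\<open>X\<close> by \<^term>\<open>R\<close> are the \<^term>\<open>R\<close>-classes, and a set of
  classes is open iff its preimage under the projection \<open>x \<mapsto> R `` {x}\<close> is open.
\<close>

definition quotient_topology :: "'a topology \<Rightarrow> ('a \<times> 'a) set \<Rightarrow> 'a set topology" where
  "quotient_topology X R =
     topology (\<lambda>U. U \<subseteq> topspace X // R \<and> openin X {x \<in> topspace X. R `` {x} \<in> U})"

lemma openin_quotient_topology:
  "openin (quotient_topology X R) U \<longleftrightarrow>
     U \<subseteq> topspace X // R \<and> openin X {x \<in> topspace X. R `` {x} \<in> U}"
proof -
  have "istopology (\<lambda>U. U \<subseteq> topspace X // R \<and> openin X {x \<in> topspace X. R `` {x} \<in> U})"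
    unfolding istopology_def
  proof (intro conjI allI impI)
    fix U V
    assume "U \<subseteq> topspace X // R \<and> openin X {x \<in> topspace X. R `` {x} \<in> U}"
      and "V \<subseteq> topspace X // R \<and> openin X {x \<in> topspace X. R `` {x} \<in> V}"
    moreover have "{x \<in> topspace X. R `` {x} \<in> U \<inter> V} =
        {x \<in> topspace X. R `` {x} \<in> U} \<inter> {x \<in> topspace X. R `` {x} \<in> V}"
      by auto
    ultimately show "U \<inter> V \<subseteq> topspace X // R"
      and "openin X {x \<in> topspace X. R `` {x} \<in> U \<inter> V}"
      by auto
  next
    fix K
    assume K: "\<forall>U\<in>K. U \<subseteq> topspace X // R \<and> openin X {x \<in> topspace X. R `` {x} \<in> U}"
    then show "\<Union>K \<subseteq> topspace X // R"
      by blast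
    have "{x \<in> topspace X. R `` {x} \<in> \<Union>K} = (\<Union>U\<in>K. {x \<in> topspace X. R `` {x} \<in> U})"
      by auto
    then show "openin X {x \<in> topspace X. R `` {x} \<in> \<Union>K}"
      using K by auto
  qed
  then show ?thesis
    by (simp add: quotient_topology_def)
qed

lemma topspace_quotient_topology [simp]: "topspace (quotient_topology X R) = topspace X // R"
proof -
  have "{x \<in> topspace X. R `` {x} \<in> topspace X // R} = topspace X"
    by (auto intro: quotientI)
  then have "openin (quotient_topology X R) (topspace X // R)"
    by (simp add: openin_quotient_topology)
  then show ?thesis
    by (meson openin_quotient_topology openin_subset openin_topspace subset_antisym)
qed

lemma quotient_map_quotient_topology:
  "quotient_map X (quotient_topology X R) (\<lambda>x. R `` {x})"
  by (auto simp: quotient_map_def openin_quotient_topology quotient_def)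


text \<open>A point of \<open>\<real>/\<int>\<close> is a coset \<open>x + \<int>\<close>, that is, a set of reals.\<close>

definition circle :: "real set topology" where
  "circle = quotient_topology euclideanreal {(x, y). y - x \<in> \<int>}"

definition rotation :: "real \<Rightarrow> real set \<Rightarrow> real set" where
  "rotation \<alpha> = (`) (\<lambda>x. x + \<alpha>)"

lemma rotation_coset:
  "rotation \<alpha> ({(x, y). y - x \<in> \<int>} `` {x}) = {(x, y). y - x \<in> \<int>} `` {x + \<alpha>}"
proof -
  have "y \<in> (\<lambda>x. x + \<alpha>) ` {y. y - x \<in> \<int>}" if "y - (x + \<alpha>) \<in> \<int>" for y
    using that by (intro image_eqI[where x = "y - \<alpha>"]) (auto simp: algebra_simps)
  then show ?thesis
    by (auto simp: rotation_def Image_def)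
qed


text \<open>
  For a bijection \<^term>\<open>S\<close> of \<^term>\<open>A\<close>, two points are in the same orbit (over \<open>\<int>\<close>) iff a forward
  iterate of one of them is the other one.
\<close>

definition orbit_relation :: "'a set \<Rightarrow> ('a \<Rightarrow> 'a) \<Rightarrow> ('a \<times> 'a) set" where
  "orbit_relation A S = {(p, q). p \<in> A \<and> q \<in> A \<and> (\<exists>n. (S ^^ n) p = q \<or> (S ^^ n) q = p)}"

lemma equiv_orbit_relation:
  assumes "bij_betw S A A"
  shows "equiv A (orbit_relation A S)"
proof (rule equivI)
  show "orbit_relation A S \<subseteq> A \<times> A"
    by (auto simp: orbit_relation_def)
  show "refl_on A (orbit_relation A S)"
    by (auto simp: orbit_relation_def refl_on_def intro: exI[of _ 0])
  show "sym (orbit_relation A S)"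
    by (auto simp: orbit_relation_def sym_def)
  have bij: "bij_betw (S ^^ n) A A" for n
    using assms by (rule bij_betw_funpow)
  have mem: "(S ^^ n) p \<in> A" if "p \<in> A" for n p
    using bij that by (meson bij_betwE)
  have cancel: "(S ^^ (n - m)) p = q" if "(S ^^ n) p = (S ^^ m) q" "m \<le> n" "p \<in> A" "q \<in> A"
    for m n p q
  proof -
    have "(S ^^ m) ((S ^^ (n - m)) p) = (S ^^ m) q"
      using that funpow_add[of m "n - m" S] by simp
    then show ?thesis
      using bij mem that by (meson bij_betw_imp_inj_on inj_onD)
  qed
  have iff: "(p, q) \<in> orbit_relation A S \<longleftrightarrow> p \<in> A \<and> q \<in> A \<and> (\<exists>m n. (S ^^ m) p = (S ^^ n) q)"
    for p q
  proof
    assume "(p, q) \<in> orbit_relation A S"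
    then show "p \<in> A \<and> q \<in> A \<and> (\<exists>m n. (S ^^ m) p = (S ^^ n) q)"
      unfolding orbit_relation_def mem_Collect_eq prod.case using funpow_0[of S] by metis
  next
    assume "p \<in> A \<and> q \<in> A \<and> (\<exists>m n. (S ^^ m) p = (S ^^ n) q)"
    then obtain m n where *: "p \<in> A" "q \<in> A" "(S ^^ m) p = (S ^^ n) q"
      by blast
    show "(p, q) \<in> orbit_relation A S"
      using * cancel[of m p n q] cancel[of n q m p] nat_le_linear[of m n]
      unfolding orbit_relation_def by auto
  qed
  show "trans (orbit_relation A S)"
  proof (rule transI)
    fix p q r
    assume "(p, q) \<in> orbit_relation A S" "(q, r) \<in> orbit_relation A S"
    then obtain k l m n where *: "p \<in> A" "q \<in> A" "r \<in> A"
      "(S ^^ k) p = (S ^^ l) q" "(S ^^ m) q = (S ^^ n) r"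
      unfolding iff by blast
    have "(S ^^ (m + k)) p = (S ^^ (l + n)) r"
    proof -
      have "(S ^^ (m + k)) p = (S ^^ (l + m)) q"
        using * by (simp add: funpow_add add.commute[of l m])
      then show ?thesis
        using * by (simp add: funpow_add)
    qed
    then show "(p, r) \<in> orbit_relation A S"
      unfolding iff using * by blast
  qed
qed

definition skew_product :: "('a \<Rightarrow> 'a) \<Rightarrow> ('a \<Rightarrow> real) \<Rightarrow> 'a \<times> real \<Rightarrow> 'a \<times> real" where
  "skew_product T g = (\<lambda>(x, r). (T x, r + g x))"

definition special_flow_space ::
    "'a topology \<Rightarrow> ('a \<Rightarrow> 'a) \<Rightarrow> ('a \<Rightarrow> real) \<Rightarrow> ('a \<times> real) set topology" where
  "special_flow_space X T f =
     quotient_topology (prod_topology X euclideanreal)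
       (orbit_relation (topspace X \<times> UNIV) (skew_product T (\<lambda>x. - f x)))"

text \<open>
  The vertical translation \<open>(x, r) \<mapsto> (x, r + t)\<close> commutes with the skew product, so it maps orbits
  onto orbits; the induced flow on the quotient sends an orbit to its image.
\<close>

definition special_flow :: "real \<Rightarrow> ('a \<times> real) set \<Rightarrow> ('a \<times> real) set" where
  "special_flow t = (`) (\<lambda>(x, r). (x, r + t))"

lemma special_flow_orbit:
  defines "R \<equiv> \<lambda>X T f. orbit_relation (topspace X \<times> UNIV) (skew_product T (\<lambda>x. - f x))"
  shows "special_flow t (R X T f `` {(x, r)}) = R X T f `` {(x, r + t)}"
proof -
  define S where "S = skew_product T (\<lambda>x. - f x)"
  define v where "v = (\<lambda>t (x :: 'a, r :: real). (x, r + t))"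
  have comm: "(S ^^ n) (v t p) = v t ((S ^^ n) p)" for n t p
    by (induction n) (auto simp: S_def v_def skew_product_def split: prod.splits)
  have sub: "(v t p, v t q) \<in> R X T f" if "(p, q) \<in> R X T f" for t p q
  proof -
    have mem: "v t p \<in> topspace X \<times> UNIV \<longleftrightarrow> p \<in> topspace X \<times> UNIV" for p
      by (auto simp: v_def split: prod.splits)
    show ?thesis
      using that unfolding R_def S_def[symmetric] orbit_relation_def mem_Collect_eq prod.case mem comm
      by metis
  qed
  have inv: "v t (v (- t) q) = q" "v (- t) (v t q) = q" for t q
    by (auto simp: v_def split: prod.splits)
  have "v t ` (R X T f `` {(x, r)}) = R X T f `` {v t (x, r)}"
  proof (intro equalityI subsetI)
    fix q assume "q \<in> R X T f `` {v t (x, r)}"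
    then have "(x, r) = v (- t) (v t (x, r)) \<and> v (- t) q \<in> R X T f `` {(x, r)}"
      using sub[of "v t (x, r)" q "- t"] by (simp add: inv)
    then show "q \<in> v t ` (R X T f `` {(x, r)})"
      by (metis image_eqI inv(1))
  qed (use sub in auto)
  then show ?thesis
    by (simp add: special_flow_def v_def)
qed


text \<open>A flow is a family of maps indexed by time, regarded on the points of its space only.\<close>

definition topologically_conjugate ::
    "'a topology \<Rightarrow> (real \<Rightarrow> 'a \<Rightarrow> 'a) \<Rightarrow> 'b topology \<Rightarrow> (real \<Rightarrow> 'b \<Rightarrow> 'b) \<Rightarrow> bool" where
  "topologically_conjugate X \<Phi> Y \<Psi> \<longleftrightarrow>
     (\<exists>h. homeomorphic_map X Y h \<and> (\<forall>t. \<forall>x\<in>topspace X. h (\<Phi> t x) = \<Psi> t (h x)))"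

definition I_top :: "'a topology \<Rightarrow> (real \<Rightarrow> 'a \<Rightarrow> 'a) \<Rightarrow> real set" where
  "I_top X \<Phi> = {s. s \<noteq> 0 \<and> topologically_conjugate X \<Phi> X (\<lambda>t. \<Phi> (s * t))}"


definition quadratic_irrational :: "real \<Rightarrow> bool" where
  "quadratic_irrational x \<longleftrightarrow>
     x \<notin> \<rat> \<and> (\<exists>a b c :: int. a \<noteq> 0 \<and> of_int a * x\<^sup>2 + of_int b * x + of_int c = 0)"

end

theory Submission
  imports Defs
begin

text \<open>
  The space of the special flow is a torus: the projection of \<open>\<real>\<^sup>2\<close> onto it is a covering with deck
  group \<open>\<int>\<^sup>2\<close>, generated by \<open>(x, r) \<mapsto> (x + 1, r)\<close> and \<open>(x, r) \<mapsto> (x + \<alpha>, r - f x)\<close>. A conjugacy \<open>h\<close>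
  between the flow and its rescaling by \<open>s\<close> lifts along the line \<open>r = 0\<close>, hence, by
  equivariance, to a map \<open>(x, r) \<mapsto> (\<phi> x, g x + s r)\<close> that intertwines deck transformations. So
  \<open>\<phi> (x + 1) = \<phi> x + a + b\<alpha>\<close> and \<open>\<phi> (x + \<alpha>) = \<phi> x + c + d\<alpha>\<close> for integers \<open>a, b, c, d\<close>; boundedness of
  the periodic function \<open>\<phi> x - (a + b\<alpha>) x\<close> forces \<open>c + d\<alpha> = (a + b\<alpha>) \<alpha>\<close>. As \<open>\<alpha>\<close> is not quadratic,
  \<open>b = c = 0\<close> and \<open>a = d\<close>, and \<open>\<phi>\<close> is affine with slope \<open>a\<close>. Comparing second coordinates, \<open>s f\<close> is
  cohomologous to the \<open>a\<close>-th Birkhoff sum of \<open>f\<close> at \<open>\<phi> x\<close>, and integration gives \<open>s = a\<close>. Applied to the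
  inverse conjugacy, the same argument shows that \<open>1 / s\<close> is an integer as well.
\<close>

section \<open>Continuous and periodic functions on the line\<close>

text \<open>The image is connected, and a connected set with two points in a metric space is
  uncountable. Used for values in Z + Z \<alpha>, which is countable but not discrete.\<close>

lemma continuous_countable_range_constant:
  fixes f :: "'a::topological_space \<Rightarrow> 'b::metric_space"
  assumes "connected S" "continuous_on S f" "f ` S \<subseteq> C" "countable C" "x \<in> S" "y \<in> S"
  shows "f x = f y"
proof (rule ccontr)
  assume "f x \<noteq> f y"
  then have "uncountable (f ` S)"
    using assms by (intro connected_uncountable[of _ "f x" "f y"] connected_continuous_image) auto
  then show False
    using assms countable_subset by blast
qed

lemma shift_int:
  fixes g :: "real \<Rightarrow> real"
  assumes "\<And>x. g (x + p) = g x + c"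
  shows "g (x + of_int n * p) = g x + of_int n * c"
proof (induction n arbitrary: x rule: int_induct[where k = 0])
  case (step1 i)
  then show ?case
    using assms[of "x + of_int i * p"] by (simp add: algebra_simps)
next
  case (step2 i)
  then show ?case
    using assms[of "x + of_int (i - 1) * p"] by (simp add: algebra_simps)
qed simp

lemma periodic_bounded:
  fixes g :: "real \<Rightarrow> real"
  assumes "continuous_on UNIV g" and per: "\<And>x. g (x + 1) = g x"
  obtains B where "\<And>x. \<bar>g x\<bar> \<le> B"
proof -
  have "bounded (g ` {0..1})"
    by (intro compact_imp_bounded compact_continuous_image continuous_on_subset[OF assms(1)]) auto
  then obtain B where B: "\<forall>y\<in>g ` {0..1}. norm y \<le> B"
    unfolding bounded_iff by blast
  have "\<bar>g x\<bar> \<le> B" for x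
  proof -
    have "g (frac x + of_int \<lfloor>x\<rfloor> * 1) = g (frac x) + of_int \<lfloor>x\<rfloor> * 0"
      by (rule shift_int) (simp add: per)
    then have "g x = g (frac x)"
      by (simp add: frac_def)
    then show ?thesis
      using B by (simp add: frac_ge_0 frac_lt_1 less_imp_le)
  qed
  then show ?thesis by (rule that)
qed

text \<open>Iterating the shift by \<open>\<alpha>\<close> gives unbounded growth unless
  \<open>c = 0\<close>. Then \<open>g\<close> is invariant under the dense group Z + Z \<alpha>, and
  continuity makes it constant.\<close>

lemma periodic_quasi_periodic_constant:
  fixes g :: "real \<Rightarrow> real"
  assumes cont: "continuous_on UNIV g" and per: "\<And>x. g (x + 1) = g x"
    and quasi: "\<And>x. g (x + \<alpha>) = g x + c" and irr: "\<alpha> \<notin> \<rat>"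
  shows "c = 0" and "g x = g y"
proof -
  obtain B where B: "\<And>x. \<bar>g x\<bar> \<le> B"
    using periodic_bounded[OF cont per] by blast
  show "c = 0"
  proof (rule ccontr)
    assume "c \<noteq> 0"
    obtain n :: nat where n: "real n * \<bar>c\<bar> > 2 * B"
      using \<open>c \<noteq> 0\<close> ex_less_of_nat_mult[of "\<bar>c\<bar>" "2 * B"] by auto
    have "g (0 + of_int (int n) * \<alpha>) = g 0 + of_int (int n) * c"
      by (rule shift_int) (rule quasi)
    then have "\<bar>real n * c\<bar> \<le> \<bar>g (real n * \<alpha>)\<bar> + \<bar>g 0\<bar>"
      by simp
    also have "\<dots> \<le> 2 * B"
      using B[of "real n * \<alpha>"] B[of 0] by linarith
    finally show False
      using n by (simp add: abs_mult)
  qed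
  have inv: "g (of_int k * \<alpha> - of_int h + z) = g z" for k h z
  proof -
    have "g (z + of_int k * \<alpha> + of_int (- h) * 1) = g (z + of_int k * \<alpha>) + of_int (- h) * 0"
      by (rule shift_int) (simp add: per)
    moreover have "g (z + of_int k * \<alpha>) = g z + of_int k * c"
      by (rule shift_int) (rule quasi)
    ultimately show ?thesis
      using \<open>c = 0\<close> by (simp add: algebra_simps)
  qed
  have "g x = g 0" for x
  proof (rule ccontr)
    assume "g x \<noteq> g 0"
    then have "\<bar>g x - g 0\<bar> > 0" by simp
    moreover have "isCont g x"
      using cont continuous_on_eq_continuous_at by blast
    ultimately obtain d where d: "d > 0" "\<And>y. \<bar>y - x\<bar> < d \<Longrightarrow> \<bar>g y - g x\<bar> < \<bar>g x - g 0\<bar>"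
      unfolding continuous_at_eps_delta dist_real_def by blast
    obtain h k :: int where "\<bar>of_int k * \<alpha> - of_int h - x\<bar> < d"
      using sequence_of_fractional_parts_is_dense[OF irr \<open>d > 0\<close>] by metis
    then show False
      using d(2) inv[of k h 0] by force
  qed
  then show "g x = g y" by metis
qed

section \<open>Birkhoff sums over the rotation\<close>

text \<open>For \<open>n < 0\<close> the first sum is empty, and the second one runs the rotation backwards.\<close>

definition birkhoff_sum :: "real \<Rightarrow> (real \<Rightarrow> real) \<Rightarrow> int \<Rightarrow> real \<Rightarrow> real" where
  "birkhoff_sum \<alpha> F n x =
     (\<Sum>i\<in>{0..<n}. F (x + of_int i * \<alpha>)) - (\<Sum>i\<in>{n..<0}. F (x + of_int i * \<alpha>))"

lemma birkhoff_sum_0 [simp]: "birkhoff_sum \<alpha> F 0 x = 0"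
  by (simp add: birkhoff_sum_def)

lemma birkhoff_sum_Suc:
  "birkhoff_sum \<alpha> F (int (Suc k)) x = birkhoff_sum \<alpha> F (int k) x + F (x + real k * \<alpha>)"
proof -
  have "{0..<int (Suc k)} = insert (int k) {0..<int k}" by auto
  then show ?thesis by (simp add: birkhoff_sum_def)
qed

lemma birkhoff_sum_minus:
  "birkhoff_sum \<alpha> F (- int k) x = - birkhoff_sum \<alpha> F (int k) (x - real k * \<alpha>)"
proof -
  have "(\<Sum>i\<in>{- int k..<0}. F (x + of_int i * \<alpha>)) =
      (\<Sum>i\<in>{0..<int k}. F (x - real k * \<alpha> + of_int i * \<alpha>))"
    by (rule sum.reindex_bij_witness[of _ "\<lambda>i. i - int k" "\<lambda>i. i + int k"])
      (auto simp: algebra_simps)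
  then show ?thesis by (simp add: birkhoff_sum_def)
qed

text \<open>At least one term remains, and all terms are positive. This gap in height later
  separates points of a fibre of \<open>proj\<close>.\<close>

lemma birkhoff_sum_abs_ge:
  assumes "\<And>x. F x \<ge> d" "n \<noteq> 0" "d > 0"
  shows "\<bar>birkhoff_sum \<alpha> F n x\<bar> \<ge> d"
proof -
  have ge: "(\<Sum>i\<in>{a..<b}. F (x + of_int i * \<alpha>)) \<ge> d" if "a < b" for a b
  proof -
    have "d \<le> F (x + of_int a * \<alpha>)" by (rule assms)
    also have "\<dots> \<le> (\<Sum>i\<in>{a..<b}. F (x + of_int i * \<alpha>))"
      using that assms(1,3) by (intro member_le_sum) (auto intro: less_imp_le order_trans)
    finally show ?thesis .
  qed
  show ?thesis
  proof (cases "n > 0")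
    case True
    then show ?thesis using ge[of 0 n] by (simp add: birkhoff_sum_def)
  next
    case False
    then show ?thesis using ge[of n 0] \<open>n \<noteq> 0\<close> by (simp add: birkhoff_sum_def)
  qed
qed

text \<open>The increment \<open>c\<close> allows for antiderivatives of periodic functions, which
  gain a constant over each period; for the roof itself \<open>c\<close> is 0.\<close>

lemma birkhoff_sum_shift:
  assumes "\<And>x. F (x + p) = F x + c"
  shows "birkhoff_sum \<alpha> F n (x + p) = birkhoff_sum \<alpha> F n x + of_int n * c"
proof -
  have "F (x + p + of_int i * \<alpha>) = F (x + of_int i * \<alpha>) + c" for i
    using assms[of "x + of_int i * \<alpha>"] by (simp add: algebra_simps)
  then show ?thesis
    by (cases "n \<ge> 0") (simp_all add: birkhoff_sum_def sum.distrib algebra_simps)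
qed

lemma birkhoff_sum_derivative:
  assumes "\<And>x. (K has_real_derivative F x) (at x)"
  shows "((\<lambda>x. birkhoff_sum \<alpha> K n (a * x + b)) has_real_derivative
    a * birkhoff_sum \<alpha> F n (a * x + b)) (at x)"
proof -
  have "((\<lambda>x. K (a * x + b + of_int i * \<alpha>)) has_real_derivative
      F (a * x + b + of_int i * \<alpha>) * a) (at x)" for i
    by (rule DERIV_chain2[OF assms]) (auto intro!: derivative_eq_intros)
  then show ?thesis
    unfolding birkhoff_sum_def
    by (auto intro!: derivative_eq_intros simp: sum_distrib_left right_diff_distrib mult.commute)
qed

lemma continuous_on_birkhoff_sum:
  assumes "continuous_on UNIV F" "continuous_on S g"
  shows "continuous_on S (\<lambda>x. birkhoff_sum \<alpha> F n (g x))"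
  unfolding birkhoff_sum_def using assms
  by (intro continuous_intros continuous_on_compose2[OF assms(1)]) auto

section \<open>Antiderivatives and means over a period\<close>

lemma continuous_has_antiderivative:
  fixes g :: "real \<Rightarrow> real"
  assumes "continuous_on UNIV g"
  obtains G where "\<And>x. (G has_real_derivative g x) (at x)"
proof -
  have "isCont g x" for x
    using assms continuous_on_eq_continuous_at by blast
  then show ?thesis
    using einterval_antiderivative[of "-\<infinity>" "\<infinity>" g] that
    by (auto simp: has_real_derivative_iff_has_vector_derivative)
qed

text \<open>The difference \<open>G (x + p) - G x\<close> has derivative zero.\<close>

lemma antiderivative_periodic_shift:
  fixes G :: "real \<Rightarrow> real"
  assumes G: "\<And>x. (G has_real_derivative g x) (at x)" and per: "\<And>x. g (x + p) = g x"
  shows "G (x + p) = G x + (G p - G 0)"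
proof -
  have "((\<lambda>x. G (x + p)) has_real_derivative g (x + p)) (at x)" for x
    using G[of "x + p"] by (simp add: DERIV_shift)
  then have "((\<lambda>x. G (x + p) - G x) has_real_derivative 0) (at x)" for x
    using DERIV_diff[OF _ G] per by fastforce
  then have "\<forall>x. ((\<lambda>x. G (x + p) - G x) has_real_derivative 0) (at x)" by blast
  from DERIV_isconst_all[OF this, of x 0] show ?thesis by simp
qed

text \<open>
  Comparison of means over a period: the left-hand side has mean zero, and the right-hand side
  has mean \<open>s - n\<close> times the mean of \<open>F\<close>.
\<close>

lemma cohomologous_birkhoff_sum_imp_eq:
  fixes F g :: "real \<Rightarrow> real"
  assumes F: "continuous_on UNIV F" "\<And>x. F (x + 1) = F x" "\<And>x. F x > 0"
    and g: "continuous_on UNIV g" "\<And>x. g (x + 1) = g x"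
    and eq: "\<And>x. g (x + \<alpha>) - g x = s * F x - birkhoff_sum \<alpha> F n (of_int n * x + b)"
  shows "s = of_int n"
proof -
  obtain K where K: "\<And>x. (K has_real_derivative F x) (at x)"
    using continuous_has_antiderivative[OF F(1)] by blast
  obtain G where G: "\<And>x. (G has_real_derivative g x) (at x)"
    using continuous_has_antiderivative[OF g(1)] by blast
  define I where "I = K 1 - K 0"
  have "K 1 > K 0"
    by (rule DERIV_pos_imp_increasing[of 0 1]) (use K F(3) in auto)
  then have "I > 0" by (simp add: I_def)
  have K1: "K (x + 1) = K x + I" for x
    unfolding I_def using antiderivative_periodic_shift[of K F 1 x] K F(2) by blast
  have Kn: "K (x + of_int n) = K x + of_int n * I" for x
    using shift_int[of K 1 I x n] K1 by simp
  have G1: "G (x + 1) = G x + (G 1 - G 0)" for x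
    using antiderivative_periodic_shift[of G g 1 x] G g(2) by blast
  \<comment> \<open>Dividing by \<open>n\<close> cancels the factor of the chain rule. For
    \<open>n = 0\<close> division by zero makes \<open>B\<close> vanish, in agreement with the empty
    sum.\<close>
  define B where "B x = birkhoff_sum \<alpha> K n (of_int n * x + b) / of_int n" for x
  have B: "(B has_real_derivative birkhoff_sum \<alpha> F n (of_int n * x + b)) (at x)" for x
  proof (cases "n = 0")
    case False
    then show ?thesis
      unfolding B_def
      using DERIV_cdivide[OF birkhoff_sum_derivative[OF K, of \<alpha> n "of_int n" b x], of "of_int n"]
      by simp
  qed (simp add: B_def[abs_def])
  have B1: "B (x + 1) = B x + of_int n * I" for x
  proof (cases "n = 0")
    case False
    have "birkhoff_sum \<alpha> K n (of_int n * x + b + of_int n) =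
        birkhoff_sum \<alpha> K n (of_int n * x + b) + of_int n * (of_int n * I)"
      by (rule birkhoff_sum_shift) (rule Kn)
    then show ?thesis
      using False by (simp add: B_def algebra_simps add_divide_distrib)
  qed (simp add: B_def)
  \<comment> \<open>The derivative of \<open>D\<close> is the difference of the two sides of
    \<open>eq\<close>, so \<open>D\<close> is constant; comparing \<open>D 1\<close> with
    \<open>D 0\<close> compares the means.\<close>
  define D where "D x = G (x + \<alpha>) - G x - s * K x + B x" for x
  have "(D has_real_derivative 0) (at x)" for x
  proof -
    have "((\<lambda>x. G (x + \<alpha>)) has_real_derivative g (x + \<alpha>)) (at x)"
      using G[of "x + \<alpha>"] by (simp add: DERIV_shift)
    then have "(D has_real_derivative g (x + \<alpha>) - g x - s * F x
        + birkhoff_sum \<alpha> F n (of_int n * x + b)) (at x)"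
      unfolding D_def by (intro derivative_intros G DERIV_cmult K B)
    then show ?thesis using eq[of x] by simp
  qed
  then have "\<forall>x. (D has_real_derivative 0) (at x)" by blast
  from DERIV_isconst_all[OF this, of 1 0]
  have "G (1 + \<alpha>) - G 1 - s * K 1 + B 1 = G \<alpha> - G 0 - s * K 0 + B 0"
    by (simp add: D_def)
  moreover have "s * K 1 = s * K 0 + s * I"
    using K1[of 0] by (simp add: distrib_left)
  ultimately have "s * I = of_int n * I"
    using G1[of \<alpha>] G1[of 0] B1[of 0] by (simp only: add_0 add.commute[of 1 \<alpha>])
  then show ?thesis using \<open>I > 0\<close> by simp
qed

section \<open>The circle as a quotient of the line\<close>

definition coset :: "real \<Rightarrow> real set" where
  "coset x = {(x, y). y - x \<in> \<int>} `` {x}"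

lemma coset_eq_iff: "coset x = coset y \<longleftrightarrow> (\<exists>m. y = x + of_int m)"
proof
  assume "coset x = coset y"
  moreover have "y \<in> coset y" by (simp add: coset_def)
  ultimately have "y \<in> coset x" by simp
  then have "y - x \<in> \<int>" by (simp add: coset_def)
  then show "\<exists>m. y = x + of_int m"
    by (metis Ints_cases add.commute diff_add_cancel)
next
  assume "\<exists>m. y = x + of_int m"
  then obtain m where m: "y = x + of_int m" by blast
  have "z - x \<in> \<int> \<longleftrightarrow> z - y \<in> \<int>" for z
  proof -
    have "z - x = (z - y) + of_int m" "z - y = (z - x) - of_int m" by (simp_all add: m)
    then show ?thesis by (metis Ints_add Ints_diff Ints_of_int)
  qed
  then show "coset x = coset y" by (auto simp: coset_def)
qed

lemma rotation_of_coset: "rotation \<alpha> (coset x) = coset (x + \<alpha>)"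
  unfolding coset_def by (rule rotation_coset)

lemma quotient_map_coset: "quotient_map euclideanreal circle coset"
  unfolding circle_def coset_def by (rule quotient_map_quotient_topology)

lemma topspace_circle: "topspace circle = range coset"
  using quotient_imp_surjective_map[OF quotient_map_coset] by simp

text \<open>The preimage of the image is the union of the integer translates of
  \<open>U\<close>.\<close>

lemma openin_circle_coset_image:
  assumes "open U"
  shows "openin circle (coset ` U)"
proof -
  have "{x. coset x \<in> coset ` U} = (\<Union>m::int. (\<lambda>x. x + of_int m) -` U)"
    using coset_eq_iff by (auto simp: image_iff)
  moreover have "open ((\<lambda>x. x + of_int m) -` U)" for m
    by (intro open_vimage assms continuous_intros)
  ultimately have "open {x. coset x \<in> coset ` U}" by auto
  moreover have "coset ` U \<subseteq> topspace circle" by (auto simp: topspace_circle)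
  ultimately show ?thesis
    using quotient_map_coset unfolding quotient_map_def by simp
qed

section \<open>The plane over the space of the special flow\<close>

locale rotation_special_flow =
  fixes \<alpha> :: real and f :: "real set \<Rightarrow> real"
  assumes irrational: "\<alpha> \<notin> \<rat>"
    and continuous_roof: "continuous_map circle euclideanreal f"
    and roof_pos: "x \<in> topspace circle \<Longrightarrow> f x > 0"
begin

definition "F x = f (coset x)"

definition "S = skew_product (rotation \<alpha>) (\<lambda>x. - f x)"

definition "X = special_flow_space circle (rotation \<alpha>) f"

definition proj :: "real \<times> real \<Rightarrow> (real set \<times> real) set" where
  "proj p = orbit_relation (topspace circle \<times> UNIV) S `` {(coset (fst p), snd p)}"

text \<open>The deck transformation of the pair (m, n): the \<open>n\<close>-th iterate of the skew
  product lifted to the plane, followed by the translation by \<open>m\<close> in the first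
  coordinate.\<close>

definition deck :: "int \<Rightarrow> int \<Rightarrow> real \<times> real \<Rightarrow> real \<times> real" where
  "deck m n p = (fst p + of_int n * \<alpha> + of_int m, snd p - birkhoff_sum \<alpha> F n (fst p))"

lemma F_plus_one: "F (x + 1) = F x"
proof -
  have "coset x = coset (x + 1)"
    unfolding coset_eq_iff by (rule exI[of _ 1]) simp
  then show ?thesis by (simp add: F_def)
qed

lemma F_pos: "F x > 0"
  by (simp add: F_def roof_pos topspace_circle)

lemma continuous_F: "continuous_on UNIV F"
proof -
  have "continuous_map euclideanreal euclideanreal (f \<circ> coset)"
    by (rule continuous_map_compose[OF quotient_imp_continuous_map[OF quotient_map_coset] continuous_roof])
  then show ?thesis by (simp add: F_def[abs_def] comp_def)
qed

text \<open>The reciprocal of \<open>F\<close> is continuous and periodic, hence bounded.\<close>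

lemma F_lower_bound:
  obtains d where "d > 0" "\<And>x. F x \<ge> d"
proof -
  have "continuous_on UNIV (\<lambda>x. 1 / F x)"
    using F_pos by (intro continuous_intros continuous_F) (auto simp: less_imp_neq[symmetric])
  then obtain B where B: "\<And>x. \<bar>1 / F x\<bar> \<le> B"
    using periodic_bounded[of "\<lambda>x. 1 / F x"] F_plus_one by metis
  have "B > 0"
    using B[of 0] F_pos[of 0] by (smt (verit) divide_pos_pos)
  moreover have "F x \<ge> 1 / B" for x
    using B[of x] F_pos[of x] \<open>B > 0\<close> by (simp add: field_simps)
  ultimately show ?thesis using that[of "1 / B"] by simp
qed

lemma irrational_int_combination:
  assumes "of_int m + of_int n * \<alpha> = of_int m' + of_int n' * \<alpha>"
  shows "m = m'" "n = n'"
proof -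
  have "of_int (n - n') * \<alpha> = of_int (m' - m)"
    using assms by (simp add: algebra_simps)
  then have "n = n'"
    using irrational by (metis Rats_divide Rats_of_int eq_iff_diff_eq_0 nonzero_mult_div_cancel_left of_int_eq_0_iff)
  then show "n = n'" "m = m'" using assms by auto
qed

lemma birkhoff_sum_F_shift: "birkhoff_sum \<alpha> F n (x + of_int m) = birkhoff_sum \<alpha> F n x"
proof -
  have "F (x + of_int m) = F x + 0" for x
    using shift_int[of F 1 0 x m] F_plus_one by simp
  then show ?thesis
    using birkhoff_sum_shift[of F "of_int m" 0] by simp
qed

lemma S_funpow:
  "(S ^^ k) (coset x, r) = (coset (x + real k * \<alpha>), r - birkhoff_sum \<alpha> F (int k) x)"
proof (induction k)
  case (Suc k)
  have "(S ^^ Suc k) (coset x, r) = S ((S ^^ k) (coset x, r))" by simp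
  also have "\<dots> = S (coset (x + real k * \<alpha>), r - birkhoff_sum \<alpha> F (int k) x)"
    by (simp only: Suc)
  also have "\<dots> = (coset (x + real (Suc k) * \<alpha>), r - birkhoff_sum \<alpha> F (int (Suc k)) x)"
    unfolding birkhoff_sum_Suc
    by (simp add: S_def skew_product_def rotation_of_coset F_def algebra_simps)
  finally show ?case .
qed simp

lemma bij_betw_S: "bij_betw S (topspace circle \<times> UNIV) (topspace circle \<times> UNIV)"
proof (rule bij_betw_byWitness[where f' = "\<lambda>(x, r). (rotation (- \<alpha>) x, r + f (rotation (- \<alpha>) x))"])
qed (auto simp: S_def skew_product_def topspace_circle rotation_of_coset)

text \<open>The iterate of \<open>S\<close> supplies \<open>n\<close>, running forward from
  \<open>p\<close> for \<open>n \<ge> 0\<close> and forward from \<open>q\<close> for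
  \<open>n \<le> 0\<close>; equality of cosets supplies \<open>m\<close>.\<close>

lemma proj_eq_iff: "proj p = proj q \<longleftrightarrow> (\<exists>m n. q = deck m n p)"
proof -
  obtain x r y t where pq: "p = (x, r)" "q = (y, t)" by (cases p, cases q)
  have *: "(S ^^ k) (coset x, r) = (coset y, t) \<longleftrightarrow> (\<exists>m. q = deck m (int k) p)" for k
    by (auto simp: S_funpow coset_eq_iff pq deck_def)
  have **: "(S ^^ k) (coset y, t) = (coset x, r) \<longleftrightarrow> (\<exists>m. q = deck m (- int k) p)" for k
  proof -
    have "(S ^^ k) (coset y, t) = (coset x, r) \<longleftrightarrow>
        (\<exists>m. x = y + real k * \<alpha> + of_int m \<and> r = t - birkhoff_sum \<alpha> F (int k) y)"
      by (auto simp: S_funpow coset_eq_iff)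
    also have "\<dots> \<longleftrightarrow> (\<exists>m. y = x - real k * \<alpha> + of_int m \<and> r = t - birkhoff_sum \<alpha> F (int k) y)"
    proof (intro iffI; elim exE)
      show "\<exists>m. y = x - real k * \<alpha> + of_int m \<and> r = t - birkhoff_sum \<alpha> F (int k) y"
        if "x = y + real k * \<alpha> + of_int m \<and> r = t - birkhoff_sum \<alpha> F (int k) y" for m
        using that by (intro exI[of _ "- m"]) simp
      show "\<exists>m. x = y + real k * \<alpha> + of_int m \<and> r = t - birkhoff_sum \<alpha> F (int k) y"
        if "y = x - real k * \<alpha> + of_int m \<and> r = t - birkhoff_sum \<alpha> F (int k) y" for m
        using that by (intro exI[of _ "- m"]) simp
    qed
    \<comment> \<open>By integer periodicity the sum from \<open>y\<close> equals the sum from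
      \<open>x - real k * \<alpha>\<close>, which is minus the sum of index \<open>- int k\<close>
      at \<open>x\<close>.\<close>
    also have "\<dots> \<longleftrightarrow> (\<exists>m. q = deck m (- int k) p)"
      by (auto simp: pq deck_def birkhoff_sum_minus birkhoff_sum_F_shift)
    finally show ?thesis .
  qed
  have "proj p = proj q \<longleftrightarrow>
      ((coset x, r), (coset y, t)) \<in> orbit_relation (topspace circle \<times> UNIV) S"
    unfolding proj_def pq fst_conv snd_conv
    by (rule eq_equiv_class_iff[OF equiv_orbit_relation[OF bij_betw_S]])
      (auto simp: topspace_circle)
  also have "\<dots> \<longleftrightarrow> (\<exists>k m. q = deck m (int k) p \<or> q = deck m (- int k) p)"
    using * ** by (auto simp: orbit_relation_def topspace_circle)
  also have "\<dots> \<longleftrightarrow> (\<exists>m n. q = deck m n p)"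
    by (metis int_cases2)
  finally show ?thesis .
qed

lemma proj_deck: "proj (deck m n p) = proj p"
  using proj_eq_iff by metis

lemma continuous_deck: "continuous_on A (deck m n)"
  unfolding deck_def
  by (intro continuous_intros continuous_on_birkhoff_sum continuous_F)

lemma X_eq: "X = quotient_topology (prod_topology circle euclideanreal)
    (orbit_relation (topspace circle \<times> UNIV) S)"
  by (simp add: X_def special_flow_space_def S_def)

lemma proj_in_X: "proj p \<in> topspace X"
  by (auto simp: X_eq proj_def topspace_circle intro!: quotientI)

lemma X_imp_proj:
  assumes "y \<in> topspace X"
  obtains p where "y = proj p"
proof -
  obtain z r where "z \<in> topspace circle"
      "y = orbit_relation (topspace circle \<times> UNIV) S `` {(z, r)}"
    using assms by (auto simp: X_eq elim!: quotientE)
  then obtain x where "y = proj (x, r)"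
    by (auto simp: proj_def topspace_circle)
  then show ?thesis by (rule that)
qed

lemma continuous_map_proj: "continuous_map euclidean X proj"
proof -
  have "continuous_map (prod_topology euclideanreal euclideanreal) circle (\<lambda>p. coset (fst p))"
    using continuous_map_compose[OF continuous_map_fst quotient_imp_continuous_map[OF quotient_map_coset]]
    by (simp add: comp_def flip: prod_topology_euclidean)
  then have "continuous_map (prod_topology euclideanreal euclideanreal)
      (prod_topology circle euclideanreal) (\<lambda>p. (coset (fst p), snd p))"
    by (intro continuous_map_pairedI continuous_map_snd)
  from continuous_map_compose[OF this
      quotient_imp_continuous_map[OF quotient_map_quotient_topology]]
  show ?thesis
    unfolding X_eq proj_def[abs_def] by (simp add: comp_def flip: prod_topology_euclidean)
qed

text \<open>The saturation of \<open>U\<close> in the plane is the union of its preimages under deck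
  transformations, hence open. As \<open>X\<close> is a quotient of the circle times the line,
  openness is then carried from the plane to that product box by box.\<close>

lemma openin_proj_image:
  assumes "open U"
  shows "openin X (proj ` U)"
proof -
  let ?W = "{p. proj p \<in> proj ` U}"
  let ?V = "{z \<in> topspace (prod_topology circle euclideanreal).
      orbit_relation (topspace circle \<times> UNIV) S `` {z} \<in> proj ` U}"
  have W_eq: "?W = (\<Union>m n. deck m n -` U)"
    unfolding image_iff proj_eq_iff by (intro set_eqI) (simp, blast)
  have W: "open ?W"
    unfolding W_eq by (intro open_UN ballI open_vimage[OF assms] continuous_deck)
  have V_iff: "(coset x, r) \<in> ?V \<longleftrightarrow> proj (x, r) \<in> proj ` U" for x r
    by (simp add: proj_def topspace_circle)
  have "openin (prod_topology circle euclideanreal) ?V"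
    unfolding openin_prod_topology_alt
  proof (intro allI impI)
    fix z r assume zr: "(z, r) \<in> ?V"
    then obtain x where x: "z = coset x" by (auto simp: topspace_circle)
    with zr have "(x, r) \<in> ?W" using V_iff by blast
    then obtain A B where AB: "open A" "open B" "(x, r) \<in> A \<times> B" "A \<times> B \<subseteq> ?W"
      by (rule open_prod_elim[OF W])
    have "coset ` A \<times> B \<subseteq> ?V"
    proof
      fix w assume "w \<in> coset ` A \<times> B"
      then obtain y t where "w = (coset y, t)" "(y, t) \<in> A \<times> B" by auto
      then show "w \<in> ?V" using AB(4) V_iff by blast
    qed
    then show "\<exists>U V. openin circle U \<and> openin euclideanreal V \<and> z \<in> U \<and> r \<in> V \<and> U \<times> V \<subseteq> ?V"
      using AB(1-3) openin_circle_coset_image x by (intro exI[of _ "coset ` A"] exI[of _ B]) auto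
  qed
  moreover have "proj ` U \<subseteq> topspace X" using proj_in_X by auto
  ultimately show ?thesis
    unfolding X_eq openin_quotient_topology topspace_quotient_topology by simp
qed

lemma special_flow_proj: "special_flow t (proj p) = proj (fst p, snd p + t)"
  unfolding proj_def S_def fst_conv snd_conv by (rule special_flow_orbit)

lemma special_flow_in_X:
  assumes "y \<in> topspace X" shows "special_flow t y \<in> topspace X"
  using assms by (metis X_imp_proj special_flow_proj proj_in_X)

section \<open>Lifting paths to the plane\<close>

text \<open>On a small box \<open>proj\<close> is open and injective, so its inverse there is
  continuous and can be composed with \<open>c\<close>.\<close>

lemma local_lift:
  fixes c :: "real \<Rightarrow> (real set \<times> real) set"
  assumes c: "continuous_map euclideanreal X c"
  obtains I q where "open I" "x \<in> I" "continuous_on I q" "\<And>t. t \<in> I \<Longrightarrow> proj (q t) = c t"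
proof -
  have "c x \<in> topspace X"
    using continuous_map_image_subset_topspace[OF c] by auto
  then obtain p where p: "proj p = c x" by (metis X_imp_proj)
  obtain d where d: "d > 0" "\<And>x. F x \<ge> d" using F_lower_bound by blast
  \<comment> \<open>Nontrivial deck transformations move this box off itself: for
    \<open>n \<noteq> 0\<close> the height changes by at least \<open>d\<close>, and for
    \<open>n = 0\<close> the abscissa changes by a nonzero integer.\<close>
  define D where "D = {fst p - 1/2<..<fst p + 1/2} \<times> {snd p - d/2<..<snd p + d/2}"
  have "open D" by (simp add: D_def open_Times)
  have "p \<in> D" using d by (auto simp: D_def mem_Times_iff)
  have inj: "inj_on proj D"
  proof (rule inj_onI)
    fix u v assume uv: "u \<in> D" "v \<in> D" "proj u = proj v"
    then obtain m n where v: "v = deck m n u" using proj_eq_iff by blast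
    have "\<bar>birkhoff_sum \<alpha> F n (fst u)\<bar> < d"
      using uv(1,2) by (auto simp: v deck_def D_def)
    then have "n = 0"
      using birkhoff_sum_abs_ge[of d F n \<alpha> "fst u"] d by fastforce
    moreover have "\<bar>of_int m :: real\<bar> < 1"
      using uv(1,2) \<open>n = 0\<close> by (auto simp: v deck_def D_def)
    moreover from this have "m = 0" by linarith
    ultimately show "u = v" by (simp add: v deck_def)
  qed
  define I where "I = {t. c t \<in> proj ` D}"
  have pre: "open {t. c t \<in> proj ` V}" if "open V" for V
    using openin_continuous_map_preimage[OF c openin_proj_image[OF that]] by simp
  define q where "q t = inv_into D proj (c t)" for t
  have q: "q t \<in> D" "proj (q t) = c t" if "t \<in> I" for t
    using that by (auto simp: I_def q_def inv_into_into f_inv_into_f)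
  \<comment> \<open>Injectivity on \<open>D\<close> turns preimages under \<open>q\<close> into
    preimages under \<open>c\<close>, so that openness of \<open>proj\<close> yields continuity of
    \<open>q\<close>.\<close>
  have "I \<inter> q -` V = {t. c t \<in> proj ` (D \<inter> V)}" for V
    using q inj by (force simp: I_def q_def)
  moreover have "open I" using pre[OF \<open>open D\<close>] by (simp add: I_def)
  ultimately have "continuous_on I q"
    using pre \<open>open D\<close> by (simp add: continuous_on_open_vimage Int_commute[of _ I] open_Int)
  moreover have "x \<in> I" using p \<open>p \<in> D\<close> by (force simp: I_def)
  ultimately show ?thesis using that \<open>open I\<close> q(2) by metis
qed

text \<open>Liftability is local and passes to unions of adjacent intervals, so bisection gives it
  on every compact interval.\<close>

lemma lift_interval:
  fixes c :: "real \<Rightarrow> (real set \<times> real) set"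
  assumes c: "continuous_map euclideanreal X c" and "a \<le> b"
  shows "\<exists>q. continuous_on {a..b} q \<and> (\<forall>t\<in>{a..b}. proj (q t) = c t)"
  using \<open>a \<le> b\<close>
proof (induction rule: Bolzano)
  case (trans a b e)
  then obtain q1 q2 where q1: "continuous_on {a..b} q1" "\<And>t. t \<in> {a..b} \<Longrightarrow> proj (q1 t) = c t"
    and q2: "continuous_on {b..e} q2" "\<And>t. t \<in> {b..e} \<Longrightarrow> proj (q2 t) = c t"
    by blast
  have "proj (q2 b) = proj (q1 b)" using q1(2) q2(2) trans by simp
  then obtain m n where mn: "q1 b = deck m n (q2 b)" using proj_eq_iff by blast
  \<comment> \<open>A deck transformation moves the second lift so that it meets the first at
    \<open>b\<close>.\<close>
  define q where "q t = (if t \<le> b then q1 t else deck m n (q2 t))" for t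
  have "continuous_on ({a..b} \<union> {b..e}) q"
    unfolding q_def
  proof (rule continuous_on_If)
    show "continuous_on {b..e} (\<lambda>t. deck m n (q2 t))"
      by (rule continuous_on_compose2[OF continuous_deck q2(1)]) auto
  qed (use q1 mn in \<open>auto simp: order_antisym\<close>)
  moreover have "{a..b} \<union> {b..e} = {a..e}" using trans by auto
  moreover have "proj (q t) = c t" if "t \<in> {a..e}" for t
    using that q1(2) q2(2) by (auto simp: q_def proj_deck)
  ultimately show ?case by auto
next
  case (local x)
  obtain I q where q: "open I" "x \<in> I" "continuous_on I q" "\<And>t. t \<in> I \<Longrightarrow> proj (q t) = c t"
    using local_lift[OF c] by metis
  then obtain d where "d > 0" "\<And>t. \<bar>t - x\<bar> < d \<Longrightarrow> t \<in> I"
    by (metis open_real)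
  then have "{a..b} \<subseteq> I" if "a \<le> x" "x \<le> b" "b - a < d" for a b
    using that by force
  with \<open>d > 0\<close> q show ?case
    by (metis continuous_on_subset subsetD)
qed

text \<open>The first coordinates of two lifts differ by an element of the countable group Z + Z
  \<alpha>. This difference is continuous, hence constant, and it is zero at \<open>a\<close>;
  irrationality then gives \<open>m = n = 0\<close>.\<close>

lemma lift_unique:
  assumes "connected J" "continuous_on J q1" "continuous_on J q2"
    and eq: "\<And>t. t \<in> J \<Longrightarrow> proj (q1 t) = proj (q2 t)"
    and ab: "a \<in> J" "b \<in> J" "q1 a = q2 a"
  shows "q1 b = q2 b"
proof -
  let ?C = "range (\<lambda>(m, n). of_int n * \<alpha> + of_int m)"
  obtain m n where b: "q2 b = deck m n (q1 b)" using eq[OF ab(2)] proj_eq_iff by blast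
  have "(\<lambda>t. fst (q2 t) - fst (q1 t)) ` J \<subseteq> ?C"
  proof clarify
    fix t assume "t \<in> J"
    then obtain m n where "q2 t = deck m n (q1 t)" using eq proj_eq_iff by blast
    then show "fst (q2 t) - fst (q1 t) \<in> ?C"
      by (intro image_eqI[of _ _ "(m, n)"]) (auto simp: deck_def)
  qed
  then have "fst (q2 a) - fst (q1 a) = fst (q2 b) - fst (q1 b)"
    using assms by (intro continuous_countable_range_constant[where S = J and C = ?C])
      (auto intro!: continuous_intros)
  then have "of_int m + of_int n * \<alpha> = of_int 0 + of_int 0 * \<alpha>"
    by (simp add: b ab deck_def)
  then have "m = 0" "n = 0" by (rule irrational_int_combination)+
  then show ?thesis by (simp add: b deck_def)
qed

text \<open>A deck transformation matches the two lifts at 0, and uniqueness extends the match to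
  the line.\<close>

lemma lifts_differ_by_deck:
  fixes q1 q2 :: "real \<Rightarrow> real \<times> real"
  assumes "continuous_on UNIV q1" "continuous_on UNIV q2" "\<And>t. proj (q1 t) = proj (q2 t)"
  obtains m n where "\<And>t. q2 t = deck m n (q1 t)"
proof -
  obtain m n where mn: "q2 0 = deck m n (q1 0)" using assms(3) proj_eq_iff by blast
  have "deck m n (q1 t) = q2 t" for t
  proof (rule lift_unique[of UNIV "\<lambda>t. deck m n (q1 t)" q2 0])
    show "continuous_on UNIV (\<lambda>t. deck m n (q1 t))"
      by (rule continuous_on_compose2[OF continuous_deck assms(1)]) auto
  qed (use assms mn in \<open>auto simp: proj_deck\<close>)
  then show ?thesis using that by metis
qed

text \<open>Lifts on the intervals \<open>{- real k..real k}\<close> with the same value at 0 agree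
  by uniqueness and fit together.\<close>

lemma lift_line:
  fixes c :: "real \<Rightarrow> (real set \<times> real) set"
  assumes c: "continuous_map euclideanreal X c"
  obtains q where "continuous_on UNIV q" "\<And>t. proj (q t) = c t"
proof -
  have "c 0 \<in> topspace X"
    using continuous_map_image_subset_topspace[OF c] by auto
  then obtain p where p: "proj p = c 0" by (metis X_imp_proj)
  have "\<exists>q. continuous_on {- real k..real k} q \<and> (\<forall>t\<in>{- real k..real k}. proj (q t) = c t) \<and> q 0 = p" for k
  proof -
    obtain q where q: "continuous_on {- real k..real k} q" "\<And>t. t \<in> {- real k..real k} \<Longrightarrow> proj (q t) = c t"
      using lift_interval[OF c, of "- real k" "real k"] by auto
    then have "proj (q 0) = proj p" using p by simp
    then obtain m n where "p = deck m n (q 0)" using proj_eq_iff by blast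
    moreover have "continuous_on {- real k..real k} (\<lambda>t. deck m n (q t))"
      by (rule continuous_on_compose2[OF continuous_deck q(1)]) auto
    ultimately show ?thesis
      using q(2) by (intro exI[of _ "\<lambda>t. deck m n (q t)"]) (auto simp: proj_deck)
  qed
  then obtain Q where Q: "\<And>k. continuous_on {- real k..real k} (Q k)"
      "\<And>k t. t \<in> {- real k..real k} \<Longrightarrow> proj (Q k t) = c t" "\<And>k. Q k 0 = p"
    by metis
  define q where "q t = Q (nat \<lceil>\<bar>t\<bar>\<rceil>) t" for t
  have dom: "t \<in> {- real (nat \<lceil>\<bar>t\<bar>\<rceil>)..real (nat \<lceil>\<bar>t\<bar>\<rceil>)}" for t
    by (simp add: abs_le_iff[symmetric] minus_le_iff) linarith
  have le: "Q j t = Q k t" if "j \<le> k" "t \<in> {- real j..real j}" for j k t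
  proof (rule lift_unique[of "{- real j..real j}" _ _ 0])
    show "continuous_on {- real j..real j} (Q k)"
      by (rule continuous_on_subset[OF Q(1)]) (use that in auto)
  qed (use that Q in auto)
  have q_eq: "q t = Q k t" if "t \<in> {- real k..real k}" for k t
    using le[of k "nat \<lceil>\<bar>t\<bar>\<rceil>" t] le[of "nat \<lceil>\<bar>t\<bar>\<rceil>" k t] that dom[of t] nat_le_linear
    unfolding q_def by metis
  have "isCont q t" for t
  proof -
    \<comment> \<open>The strict inequality puts \<open>t\<close> in the interior, where continuity
      on the interval gives continuity at \<open>t\<close>.\<close>
    obtain k where k: "\<bar>t\<bar> < real k" using reals_Archimedean2 by blast
    then have t: "t \<in> {- real k<..<real k}" by auto
    have "continuous_on {- real k..real k} q"
      using q_eq by (intro continuous_on_eq[OF Q(1)]) simp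
    then have "continuous_on {- real k<..<real k} q"
      by (rule continuous_on_subset) auto
    then show ?thesis using t continuous_on_eq_continuous_at[of "{- real k<..<real k}" q] by simp
  qed
  then have "continuous_on UNIV q" by (simp add: continuous_at_imp_continuous_on)
  moreover have "proj (q t) = c t" for t
    unfolding q_def using Q(2) dom by blast
  ultimately show ?thesis by (rule that)
qed

section \<open>Conjugacies and their time scales\<close>

text \<open>Formulated for continuous equivariant maps, so that it applies to a conjugacy with
  factor \<open>s\<close> and to its inverse with factor \<open>1 / s\<close>.\<close>

lemma conjugate_imp_integer:
  assumes nonquadratic: "\<not> quadratic_irrational \<alpha>"
    and h: "continuous_map X X h"
    and conj: "\<And>t y. y \<in> topspace X \<Longrightarrow> h (special_flow t y) = special_flow (s * t) (h y)"
  shows "s \<in> \<int>"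
proof -
  have "continuous_map euclideanreal euclidean (\<lambda>x. (x, 0 :: real))"
    by (simp add: continuous_on_Pair)
  then have "continuous_map euclideanreal X (h \<circ> (proj \<circ> (\<lambda>x. (x, 0))))"
    by (intro continuous_map_compose[OF _ h] continuous_map_compose[OF _ continuous_map_proj])
  then obtain q where q: "continuous_on UNIV q" "\<And>x. proj (q x) = h (proj (x, 0))"
    using lift_line by (metis comp_apply)
  \<comment> \<open>Equivariance extends the lift from the line \<open>r = 0\<close> to every
    height.\<close>
  have H: "h (proj (x, r)) = proj (fst (q x), snd (q x) + s * r)" for x r
  proof -
    have "h (special_flow r (proj (x, 0))) = special_flow (s * r) (proj (q x))"
      by (simp add: conj[OF proj_in_X] q(2))
    then show ?thesis by (simp add: special_flow_proj)
  qed
  have shifts: "proj (x + 1, 0) = proj (x, 0)" "proj (x + \<alpha>, - F x) = proj (x, 0)" for x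
    using proj_deck[of 1 0 "(x, 0)"] proj_deck[of 0 1 "(x, 0)"]
      birkhoff_sum_Suc[of \<alpha> F 0 x] by (simp_all add: deck_def)
  have qc: "continuous_on UNIV (\<lambda>x. q (x + a))" for a
    by (rule continuous_on_compose2[OF q(1)]) (auto intro!: continuous_intros)
  have eq1: "proj (q x) = proj (q (x + 1))" for x
    by (simp add: q(2) shifts)
  then obtain a b where ab: "\<And>x. q (x + 1) = deck a b (q x)"
    using lifts_differ_by_deck[OF q(1) qc[of 1] eq1] by blast
  \<comment> \<open>The second generator sends \<open>(x, 0)\<close> to
    \<open>(x + \<alpha>, - F x)\<close>, and \<open>H\<close> at height \<open>- F x\<close>
    produces the correction by \<open>s * F x\<close>.\<close>
  have eq2: "proj (q x) = proj (fst (q (x + \<alpha>)), snd (q (x + \<alpha>)) - s * F x)" for x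
    using H[of "x + \<alpha>" "- F x"] by (simp add: q(2) shifts)
  have qc2: "continuous_on UNIV (\<lambda>x. (fst (q (x + \<alpha>)), snd (q (x + \<alpha>)) - s * F x))"
    by (intro continuous_intros qc continuous_F)
  obtain c d where
    cd: "\<And>x. (fst (q (x + \<alpha>)), snd (q (x + \<alpha>)) - s * F x) = deck c d (q x)"
    using lifts_differ_by_deck[OF q(1) qc2 eq2] by blast
  \<comment> \<open>Removing the slope dictated by \<open>ab\<close> makes the first coordinate
    periodic.\<close>
  define u where "u x = fst (q x) - (of_int a + of_int b * \<alpha>) * x" for x
  have u: "continuous_on UNIV u" unfolding u_def by (intro continuous_intros q)
  have u1: "u (x + 1) = u x" for x
    using ab[of x] by (simp add: u_def deck_def algebra_simps)
  have u2: "u (x + \<alpha>) = u x + (of_int d * \<alpha> + of_int c - (of_int a + of_int b * \<alpha>) * \<alpha>)" for x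
    using cd[of x] by (simp add: u_def deck_def algebra_simps)
  have quad: "of_int d * \<alpha> + of_int c - (of_int a + of_int b * \<alpha>) * \<alpha> = 0"
    and u_const: "u x = u 0" for x
    using periodic_quasi_periodic_constant[OF u u1 u2 irrational] by blast+
  \<comment> \<open>Unless \<open>b = 0\<close> this is a quadratic equation for
    \<open>\<alpha>\<close>.\<close>
  have "of_int b * \<alpha>\<^sup>2 + of_int (a - d) * \<alpha> + of_int (- c) = 0"
    using quad by (simp add: algebra_simps power2_eq_square)
  then have "b = 0"
    using nonquadratic irrational unfolding quadratic_irrational_def by blast
  moreover from this quad have "of_int c + of_int d * \<alpha> = of_int 0 + of_int a * \<alpha>"
    by simp
  then have "c = 0" "d = a" by (rule irrational_int_combination)+
  ultimately have fst_q: "fst (q x) = of_int a * x + u 0" for x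
    using u_const[of x] by (simp add: u_def)
  have "s = of_int a"
  \<comment> \<open>As \<open>b = 0\<close>, the second coordinate of the lift is periodic; as
    \<open>d = a\<close>, the second component of \<open>cd\<close> is the required cohomological
    equation.\<close>
  proof (rule cohomologous_birkhoff_sum_imp_eq[of F "\<lambda>x. snd (q x)" \<alpha> s a "u 0"])
    show "continuous_on UNIV (\<lambda>x. snd (q x))" by (intro continuous_intros q)
    show "snd (q (x + 1)) = snd (q x)" for x
      using ab[of x] \<open>b = 0\<close> by (simp add: deck_def)
    show "snd (q (x + \<alpha>)) - snd (q x) = s * F x - birkhoff_sum \<alpha> F a (of_int a * x + u 0)" for x
      using cd[of x] \<open>d = a\<close> fst_q[of x] by (simp add: deck_def)
  qed (auto intro: continuous_F F_plus_one F_pos)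
  then show ?thesis by simp
qed

text \<open>Apply \<open>k\<close> to the equation for \<open>h\<close> at the point
  \<open>k y\<close> and time \<open>1 / s * t\<close>.\<close>

lemma inverse_conjugacy:
  assumes h: "homeomorphic_maps X X h k" and "s \<noteq> 0"
    and conj: "\<And>t y. y \<in> topspace X \<Longrightarrow> h (special_flow t y) = special_flow (s * t) (h y)"
    and "y \<in> topspace X"
  shows "k (special_flow t y) = special_flow (1 / s * t) (k y)"
proof -
  have "continuous_map X X k" and hk: "h (k y) = y" "\<And>z. z \<in> topspace X \<Longrightarrow> k (h z) = z"
    using h \<open>y \<in> topspace X\<close> by (auto simp: homeomorphic_maps_def)
  then have ky: "k y \<in> topspace X"
    using \<open>y \<in> topspace X\<close> continuous_map_image_subset_topspace by fast
  have "h (special_flow (1 / s * t) (k y)) = special_flow t y"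
    using conj[OF ky, of "1 / s * t"] \<open>s \<noteq> 0\<close> hk(1) by simp
  then show ?thesis
    using hk(2)[OF special_flow_in_X[OF ky], of "1 / s * t"] by simp
qed

end

text \<open>The two integers have product 1, so they are units.\<close>

lemma int_and_inverse_int:
  fixes s :: real
  assumes "s \<in> \<int>" "1 / s \<in> \<int>" "s \<noteq> 0"
  shows "s \<in> {1, -1}"
proof -
  obtain a b where ab: "s = of_int a" "1 / s = of_int b" using assms by (auto elim!: Ints_cases)
  then have "of_int (a * b) = s * (1 / s)" by simp
  also have "\<dots> = 1" using assms(3) by simp
  finally have "a * b = 1" by (simp only: of_int_eq_1_iff)
  then show ?thesis using ab zmult_eq_1_iff by auto
qed

theorem corollary8p6:
  fixes \<alpha> :: real and f :: "real set \<Rightarrow> real"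
  assumes "\<alpha> \<notin> \<rat>"
    and "continuous_map circle euclideanreal f"
    and "\<And>x. x \<in> topspace circle \<Longrightarrow> f x > 0"
    and "\<not> quadratic_irrational \<alpha>"
  shows "I_top (special_flow_space circle (rotation \<alpha>) f) special_flow \<subseteq> {1, -1}"
proof
  interpret rotation_special_flow \<alpha> f
    by unfold_locales (use assms in auto)
  fix s assume "s \<in> I_top (special_flow_space circle (rotation \<alpha>) f) special_flow"
  then obtain h k where "s \<noteq> 0" and hk: "homeomorphic_maps X X h k"
    and conj: "\<And>t y. y \<in> topspace X \<Longrightarrow> h (special_flow t y) = special_flow (s * t) (h y)"
    unfolding I_top_def topologically_conjugate_def X_def[symmetric] homeomorphic_map_maps by blast
  have "continuous_map X X h" "continuous_map X X k"
    using hk by (auto simp: homeomorphic_maps_def)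
  then have "s \<in> \<int>" "1 / s \<in> \<int>"
    using conjugate_imp_integer[OF assms(4)] conj inverse_conjugacy[OF hk \<open>s \<noteq> 0\<close> conj] by blast+
  then show "s \<in> {1, -1}" using \<open>s \<noteq> 0\<close> by (rule int_and_inverse_int)
qed

end
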